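(* For the class of $R$-instances of the DLAGP problem, the smallest achievable sub-optimality gap $\tau_{\min}$ lies in the interval $[\tfrac12 \epsilon R, 5\epsilon R]$. In other words: (i) When $\tau < \epsilon R/2$, no algorithm can guarantee a sub-optimality gap of at most $\tau$ over all $R$-instances, even with infinitely many approximate gradient queries. This is true even if the values $\epsilon, \tau, R, L$ are all known to the algorithm. (ii) Conversely, whenever $\tau \ge 5\epsilon R$, the server can always achieve a sub-optimality gap of at most $\tau$ for all $R$-instances.
   Context: All norms are Euclidean. A differentiable function is $L$-smooth if its gradient is $L$-Lipschitz. DLAGP (distributed learning with adversarial gradient perturbations): there are $n$ clients; client $i \in \{1,\dots,n\}$ holds a convex and $L$-smooth loss function $\ell_i : \mathbb{R}^d \to \mathbb{R}$. Let $f(w) = \frac1n \sum_{i=1}^n \ell_i(w)$, which is minimized at some $w^* \in \mathbb{R}^d$; when multiple minimizers exist, $w^*$ is one with the smallest norm. The sub-optimality gap of $w \in \mathbb{R}^d$ is $f(w)-f(w^* )$. The server's goal is to find a vector whose sub-optimality gap is at most a given $\tau > 0$. Communication between the server and the clients is limited to approximate gradient queries: the server selects $i \in \{1,\dots,n\}$ and sends client $i$ a vector $w \in \mathbb{R}^d$; the client replies with a vector $v$ satisfying $\|v - \nabla \ell_i(w)\| \le \epsilon$, where $\epsilon$ is a value agreed upon in advance by the server and all clients. The reply may be an arbitrary vector satisfying this inequality, including one chosen adversarially. An $R$-instance is an instance of DLAGP for which a bound $\|w^*\| \le R$ is known. For this class, $\tau_{\min}$ is the smallest value such that, for all $R$-instances,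 it is possible for the server to find a vector $w$ satisfying $f(w) \le f(w^* ) + \tau_{\min}$, possibly using infinitely many queries. *)

theory Defs
  imports "HOL-Analysis.Analysis"
begin

definition gradient :: "('v::real_inner \<Rightarrow> real) \<Rightarrow> 'v \<Rightarrow> 'v" where
  "gradient f x = (THE g. GDERIV f x :> g)"

text \<open>\<open>lipschitz_on\<close> includes \<open>0 \<le> L\<close>, so no separate sign condition on \<open>L\<close> is needed below.\<close>

definition smooth_with :: "real \<Rightarrow> ('v::real_inner \<Rightarrow> real) \<Rightarrow> bool" where
  "smooth_with L f \<longleftrightarrow> (\<forall>x. f differentiable (at x)) \<and> L-lipschitz_on UNIV (gradient f)"

definition mean_loss :: "nat \<Rightarrow> (nat \<Rightarrow> 'v \<Rightarrow> real) \<Rightarrow> 'v \<Rightarrow> real" where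
  "mean_loss n l w = (1 / real n) * (\<Sum>i=1..n. l i w)"

definition min_norm_minimizer :: "('v::real_inner \<Rightarrow> real) \<Rightarrow> 'v \<Rightarrow> bool" where
  "min_norm_minimizer f w \<longleftrightarrow> is_arg_min norm (is_arg_min f (\<lambda>_. True)) w"

text \<open>An instance with \<open>n\<close> clients, indexed by \<open>{1..n}\<close>: \<open>l i\<close> is the loss of client \<open>i\<close>
  and \<open>ws\<close> is the minimizer $w^*$.\<close>

definition dlagp_instance ::
    "nat \<Rightarrow> real \<Rightarrow> (nat \<Rightarrow> 'v::real_inner \<Rightarrow> real) \<Rightarrow> 'v \<Rightarrow> bool" where
  "dlagp_instance n L l ws \<longleftrightarrow>
     (\<forall>i\<in>{1..n}. convex_on UNIV (l i) \<and> smooth_with L (l i)) \<and>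
     min_norm_minimizer (mean_loss n l) ws"

definition R_instance ::
    "real \<Rightarrow> nat \<Rightarrow> real \<Rightarrow> (nat \<Rightarrow> 'v::real_inner \<Rightarrow> real) \<Rightarrow> 'v \<Rightarrow> bool" where
  "R_instance R n L l ws \<longleftrightarrow> dlagp_instance n L l ws \<and> norm ws \<le> R"

text \<open>One round of communication: the client \<open>i\<close> asked, the vector \<open>w\<close> sent, the reply \<open>v\<close>.\<close>

type_synonym 'v exchange = "nat \<times> 'v \<times> 'v"

text \<open>The server chooses each query from the exchanges so far (oldest first), and
  its answer from the whole infinite sequence of exchanges; both are arbitrary functions, with no
  computability requirement. Servers that stop after finitely many queries are covered, since
  the answer may depend on an initial segment only.\<close>

record 'v server =
  next_query :: "'v exchange list \<Rightarrow> nat \<times> 'v"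
  answer :: "(nat \<Rightarrow> 'v exchange) \<Rightarrow> 'v"

text \<open>Asking only existing clients is an obligation of the server. If it were a condition
  on runs instead, a server with an illegal query would have no runs and so would
  guarantee everything.\<close>

definition valid_server :: "nat \<Rightarrow> 'v server \<Rightarrow> bool" where
  "valid_server n A \<longleftrightarrow> (\<forall>h. fst (next_query A h) \<in> {1..n})"

text \<open>The replies in a run are arbitrary within the error bound, so quantifying over all runs
  covers every adaptive adversary; repeated queries may get different replies.\<close>

definition run :: "real \<Rightarrow> (nat \<Rightarrow> 'v::real_inner \<Rightarrow> real) \<Rightarrow> 'v server \<Rightarrow> (nat \<Rightarrow> 'v exchange) \<Rightarrow> bool" where
  "run \<epsilon> l A T \<longleftrightarrow>
     (\<forall>t. case T t of (i, w, v) \<Rightarrow>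
        (i, w) = next_query A (map T [0..<t]) \<and> norm (v - gradient (l i) w) \<le> \<epsilon>)"

definition guarantees ::
    "nat \<Rightarrow> real \<Rightarrow> real \<Rightarrow> real \<Rightarrow> 'v::real_inner server \<Rightarrow> real \<Rightarrow> bool" where
  "guarantees n \<epsilon> R L A \<tau> \<longleftrightarrow>
     valid_server n A \<and>
     (\<forall>l ws T. R_instance R n L l ws \<longrightarrow> run \<epsilon> l A T \<longrightarrow>
        mean_loss n l (answer A T) - mean_loss n l ws \<le> \<tau>)"

text \<open>The class of \<open>R\<close>-instances comprises every smoothness constant \<open>L\<close>; the server is
  chosen for given \<open>n\<close>, \<open>\<epsilon>\<close>, \<open>R\<close>, \<open>\<tau>\<close> but is not told \<open>L\<close>.
  The type argument fixes the dimension \<open>CARD('d)\<close>.\<close>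

definition tau_min :: "'d::finite itself \<Rightarrow> nat \<Rightarrow> real \<Rightarrow> real \<Rightarrow> real" where
  "tau_min _ n \<epsilon> R = Inf {\<tau>. \<exists>A :: (real ^ 'd) server. \<forall>L. guarantees n \<epsilon> R L A \<tau>}"

end

(* Upper bound: the server queries every client on a countable dense set of points and answers with
   the minimizer w' of any R-instance consistent with the replies. On the dense set, hence everywhere
   by continuity, the true and the hypothetical client gradients differ by at most 2 eps. As the
   hypothetical mean gradient vanishes at w', convexity bounds the gap by
   2 eps * |w' - w*| <= 4 eps R.

   Lower bound: the gradients of (eps / 2R) |w - p|^2 and (eps / 2R) |w + p|^2 with |p| = R are both
   within eps of (eps / R) w, so an adversary sending that reply hides which of them is the
   loss; by the parallelogram law no answer has gap below eps R / 2 for both. *)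
theory Submission
  imports Defs
begin

section \<open>Gradients and the tangent inequality for convex functions\<close>

lemma GDERIV_unique:
  assumes "GDERIV f x :> g" and "GDERIV f x :> h"
  shows "g = h"
proof -
  have "(\<lambda>k. inner k g) = (\<lambda>k. inner k h)"
    using assms unfolding gderiv_def by (rule has_derivative_unique)
  then have "inner (g - h) g = inner (g - h) h"
    by meson
  then show ?thesis
    by (metis inner_diff_right inner_eq_zero_iff right_minus_eq)
qed

lemma gradient_eqI:
  assumes "GDERIV f x :> g"
  shows "gradient f x = g"
  unfolding gradient_def using assms GDERIV_unique by blast

text \<open>In finite dimension the derivative, being a linear functional, is represented by the
  vector of its values on the basis.\<close>

lemma GDERIV_gradient:
  fixes f :: "'v::euclidean_space \<Rightarrow> real"
  assumes "f differentiable (at x)"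
  shows "GDERIV f x :> gradient f x"
proof -
  obtain f' where f': "(f has_derivative f') (at x)"
    using assms unfolding differentiable_def by blast
  interpret linear f'
    using f' by (rule has_derivative_linear)
  have "f' h = inner h (\<Sum>b\<in>Basis. f' b *\<^sub>R b)" for h
  proof -
    have "f' h = f' (\<Sum>b\<in>Basis. inner h b *\<^sub>R b)"
      by (simp add: euclidean_representation)
    also have "\<dots> = inner h (\<Sum>b\<in>Basis. f' b *\<^sub>R b)"
      by (simp add: sum scale inner_sum_right mult.commute)
    finally show ?thesis .
  qed
  then have "f' = (\<lambda>h. inner h (\<Sum>b\<in>Basis. f' b *\<^sub>R b))"
    by blast
  then have "GDERIV f x :> (\<Sum>b\<in>Basis. f' b *\<^sub>R b)"
    using f' unfolding gderiv_def by metis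
  then show ?thesis
    using gradient_eqI by metis
qed

text \<open>Restricting \<open>f\<close> to the line from \<open>x\<close> to \<open>y\<close>
  reduces this to the tangent inequality in one real variable, with the tangent at 0 evaluated at
  1.\<close>

lemma convex_above_gradient:
  fixes f :: "'v::real_inner \<Rightarrow> real"
  assumes f: "convex_on UNIV f" and g: "GDERIV f x :> g"
  shows "inner (y - x) g \<le> f y - f x"
proof -
  let ?p = "\<lambda>t::real. x + t *\<^sub>R (y - x)"
  have "convex_on UNIV (f \<circ> ?p)"
  proof (rule convex_onI)
    fix t a b :: real
    assume t: "0 < t" "t < 1"
    have "?p ((1 - t) *\<^sub>R a + t *\<^sub>R b) = (1 - t) *\<^sub>R ?p a + t *\<^sub>R ?p b"
      by (simp add: algebra_simps)
    then show "(f \<circ> ?p) ((1 - t) *\<^sub>R a + t *\<^sub>R b) \<le> (1 - t) * (f \<circ> ?p) a + t * (f \<circ> ?p) b"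
      using convex_onD[OF f, of t "?p a" "?p b"] t by simp
  qed simp
  moreover have "((f \<circ> ?p) has_field_derivative inner (y - x) g) (at 0)"
  proof -
    have p: "(?p has_derivative (\<lambda>t. t *\<^sub>R (y - x))) (at 0)"
      by (auto intro!: derivative_eq_intros)
    have "(f has_derivative (\<lambda>h. inner h g)) (at (?p 0))"
      using g by (simp add: gderiv_def)
    from diff_chain_at[OF p this]
    have "((f \<circ> ?p) has_derivative (\<lambda>t. inner (t *\<^sub>R (y - x)) g)) (at 0)"
      by (simp add: comp_def)
    then show ?thesis
      by (simp add: has_field_derivative_def mult_commute_abs)
  qed
  ultimately show ?thesis
    using convex_on_imp_above_tangent[of UNIV "f \<circ> ?p" 0 1 "inner (y - x) g"] by simp
qed

section \<open>First-order optimality and comparison of two instances\<close>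

lemma min_norm_minimizer_le:
  assumes "min_norm_minimizer f w"
  shows "f w \<le> f y"
  using assms unfolding min_norm_minimizer_def is_arg_min_linorder by blast

lemma R_instance_GDERIV:
  fixes l :: "nat \<Rightarrow> 'v::euclidean_space \<Rightarrow> real"
  assumes "R_instance R n L l ws" and "i \<in> {1..n}"
  shows "GDERIV (l i) x :> gradient (l i) x"
  using assms GDERIV_gradient unfolding R_instance_def dlagp_instance_def smooth_with_def by blast

lemma R_instance_gradient_continuous:
  fixes l :: "nat \<Rightarrow> 'v::real_inner \<Rightarrow> real"
  assumes "R_instance R n L l ws" and "i \<in> {1..n}"
  shows "continuous_on UNIV (gradient (l i))"
  using assms lipschitz_on_continuous_on
  unfolding R_instance_def dlagp_instance_def smooth_with_def by blast

lemma R_instance_sum_gradient_zero: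
  fixes l :: "nat \<Rightarrow> 'v::euclidean_space \<Rightarrow> real"
  assumes inst: "R_instance R n L l ws" and n: "n \<ge> 1"
  shows "(\<Sum>i=1..n. gradient (l i) ws) = 0"
proof -
  \<comment> \<open>The sum without the factor \<open>1 / real n\<close> has the same minimizers,
    since \<open>n \<ge> 1\<close>.\<close>
  define F where "F = (\<lambda>w. \<Sum>i=1..n. l i w)"
  define G where "G = (\<Sum>i=1..n. gradient (l i) ws)"
  have "((\<lambda>w. \<Sum>i=1..n. l i w) has_derivative (\<lambda>h. \<Sum>i=1..n. inner h (gradient (l i) ws))) (at ws)"
    using R_instance_GDERIV[OF inst] unfolding gderiv_def
    by (intro has_derivative_sum) blast
  then have F: "(F has_derivative (\<lambda>h. inner h G)) (at ws)"
    by (simp add: F_def G_def inner_sum_right)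
  have "F ws \<le> F y" for y
  proof -
    have "mean_loss n l ws \<le> mean_loss n l y"
      using inst min_norm_minimizer_le unfolding R_instance_def dlagp_instance_def by blast
    then show ?thesis
      using n by (simp add: mean_loss_def F_def divide_right_mono divide_le_cancel)
  qed
  then have "(\<lambda>h. inner h G) = (\<lambda>h. 0)"
    using differential_zero_maxmin[OF _ open_UNIV F] by blast
  then have "inner G G = 0"
    by meson
  then show ?thesis
    by (simp add: G_def)
qed

text \<open>Core estimate of the upper bound: \<open>l\<close> is the true instance and
  \<open>l'\<close> a hypothetical one, possibly with another smoothness constant. Gradients need
  only be compared at the proposed answer \<open>ws'\<close>. The factor \<open>2 * R\<close> bounds
  the distance between two points of the ball of radius \<open>R\<close>.\<close>

lemma gap_le_of_gradients_close:
  fixes l l' :: "nat \<Rightarrow> 'v::euclidean_space \<Rightarrow> real"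
  assumes inst: "R_instance R n L l ws" and inst': "R_instance R n L' l' ws'"
    and n: "n \<ge> 1"
    and close: "\<And>i. i \<in> {1..n} \<Longrightarrow> norm (gradient (l i) ws' - gradient (l' i) ws') \<le> \<delta>"
  shows "mean_loss n l ws' - mean_loss n l ws \<le> \<delta> * (2 * R)"
proof -
  have dist: "norm (ws' - ws) \<le> 2 * R"
    using norm_triangle_ineq4[of ws' ws] inst inst' by (simp add: R_instance_def)
  have tangent: "l i ws' - l i ws \<le> inner (ws' - ws) (gradient (l i) ws')" if "i \<in> {1..n}" for i
  proof -
    have "convex_on UNIV (l i)"
      using inst that unfolding R_instance_def dlagp_instance_def by blast
    from convex_above_gradient[OF this R_instance_GDERIV[OF inst that], of ws ws']
    show ?thesis
      by (simp add: inner_diff_left)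
  qed
  have "(\<Sum>i=1..n. l i ws' - l i ws) \<le> (\<Sum>i=1..n. inner (ws' - ws) (gradient (l i) ws'))"
    using tangent by (rule sum_mono)
  \<comment> \<open>The subtracted sum is zero because \<open>ws'\<close> minimizes the mean of
    \<open>l'\<close>.\<close>
  also have "\<dots> = (\<Sum>i=1..n. inner (ws' - ws) (gradient (l i) ws'))
      - inner (ws' - ws) (\<Sum>i=1..n. gradient (l' i) ws')"
    using R_instance_sum_gradient_zero[OF inst' n] by simp
  also have "\<dots> = (\<Sum>i=1..n. inner (ws' - ws) (gradient (l i) ws' - gradient (l' i) ws'))"
    by (simp add: inner_sum_right inner_diff_right sum_subtractf)
  also have "\<dots> \<le> (\<Sum>i=1..n. \<delta> * (2 * R))"
  proof (rule sum_mono)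
    fix i assume i: "i \<in> {1..n}"
    have "inner (ws' - ws) (gradient (l i) ws' - gradient (l' i) ws')
        \<le> norm (ws' - ws) * norm (gradient (l i) ws' - gradient (l' i) ws')"
      by (rule norm_cauchy_schwarz)
    also have "\<dots> \<le> (2 * R) * \<delta>"
      using close[OF i] dist order_trans[OF norm_ge_zero dist] by (intro mult_mono) auto
    finally show "inner (ws' - ws) (gradient (l i) ws' - gradient (l' i) ws') \<le> \<delta> * (2 * R)"
      by (simp add: mult.commute)
  qed
  finally have "(\<Sum>i=1..n. l i ws') - (\<Sum>i=1..n. l i ws) \<le> real n * (\<delta> * (2 * R))"
    by (simp add: sum_subtractf)
  then show ?thesis
    using n by (simp add: mean_loss_def field_simps)
qed

text \<open>The smoothness constant is quantified existentially, so that the server's answer can be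
  chosen without knowing it.\<close>

definition consistent_minimizer ::
    "nat \<Rightarrow> real \<Rightarrow> real \<Rightarrow> (nat \<Rightarrow> 'v::real_inner exchange) \<Rightarrow> 'v \<Rightarrow> bool" where
  "consistent_minimizer n \<epsilon> R T w \<longleftrightarrow>
     (\<exists>L l. R_instance R n L l w \<and> (\<forall>t. case T t of (i, x, v) \<Rightarrow> norm (v - gradient (l i) x) \<le> \<epsilon>))"

text \<open>The set of violations is open, so if it were nonempty it would contain a point of
  \<open>D\<close>.\<close>

lemma le_on_dense:
  fixes g h :: "'a::topological_space \<Rightarrow> real"
  assumes "continuous_on UNIV g" and "continuous_on UNIV h"
    and dense: "\<And>X. open X \<Longrightarrow> X \<noteq> {} \<Longrightarrow> \<exists>d\<in>D. d \<in> X"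
    and le: "\<And>d. d \<in> D \<Longrightarrow> g d \<le> h d"
  shows "g x \<le> h x"
proof (rule ccontr)
  assume "\<not> g x \<le> h x"
  then have "{x. h x < g x} \<noteq> {}"
    by (auto simp: not_le)
  moreover have "open {x. h x < g x}"
    using assms(2,1) by (rule open_Collect_less)
  ultimately obtain d where "d \<in> D" "h d < g d"
    using dense by blast
  then show False
    using le by fastforce
qed

text \<open>The queries are not adaptive: the length of the history alone selects the next pair of
  client and dense point. The constant 4 is the gradient discrepancy \<open>2 * \<epsilon>\<close>
  times the distance \<open>2 * R\<close>.\<close>

lemma ex_server_guarantees:
  fixes \<epsilon> R :: real
  assumes n: "n \<ge> 1"
  shows "\<exists>A :: 'v::euclidean_space server. \<forall>L. guarantees n \<epsilon> R L A (4 * \<epsilon> * R)"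
proof -
  obtain D :: "'v set" where D: "countable D" "\<And>X. open X \<Longrightarrow> X \<noteq> {} \<Longrightarrow> \<exists>d\<in>D. d \<in> X"
    using countable_dense_setE by blast
  define q where "q = from_nat_into ({1..n} \<times> D)"
  have "D \<noteq> {}"
    using D(2)[of UNIV] by auto
  then have q: "range q = {1..n} \<times> D"
    unfolding q_def using n D(1) by (intro range_from_nat_into) auto
  define A where "A = \<lparr>next_query = \<lambda>h. q (length h),
      answer = \<lambda>T. SOME w. consistent_minimizer n \<epsilon> R T w\<rparr>"
  have "fst (q k) \<in> {1..n}" for k
    using q rangeI[of q k] by (metis mem_Times_iff)
  then have "valid_server n A"
    by (simp add: valid_server_def A_def)
  moreover have "mean_loss n l (answer A T) - mean_loss n l ws \<le> 4 * \<epsilon> * R"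
    if inst: "R_instance R n L l ws" and run: "run \<epsilon> l A T" for L l ws T
  proof -
    have reply: "norm (v - gradient (l i) x) \<le> \<epsilon>" if "T t = (i, x, v)" for t i x v
      using run[unfolded run_def, rule_format, of t] that by simp
    have query: "(i, x) = q t" if "T t = (i, x, v)" for t i x v
      using run[unfolded run_def, rule_format, of t] that by (simp add: A_def)
    \<comment> \<open>The true minimizer is itself a candidate, so the choice made by
      \<open>answer\<close> yields a genuine one.\<close>
    have "consistent_minimizer n \<epsilon> R T ws"
      unfolding consistent_minimizer_def using inst reply by blast
    then have "consistent_minimizer n \<epsilon> R T (answer A T)"
      unfolding A_def by (simp add: someI[of "consistent_minimizer n \<epsilon> R T"])
    then obtain L' l' where inst': "R_instance R n L' l' (answer A T)"
      and "\<forall>t. case T t of (i, x, v) \<Rightarrow> norm (v - gradient (l' i) x) \<le> \<epsilon>"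
      unfolding consistent_minimizer_def by blast
    then have reply': "norm (v - gradient (l' i) x) \<le> \<epsilon>" if "T t = (i, x, v)" for t i x v
      using that by (metis case_prod_conv)
    have "norm (gradient (l i) x - gradient (l' i) x) \<le> 2 * \<epsilon>" if i: "i \<in> {1..n}" for i x
    proof (rule le_on_dense[where g = "\<lambda>x. norm (gradient (l i) x - gradient (l' i) x)"
          and h = "\<lambda>_. 2 * \<epsilon>", OF _ _ D(2)])
      show "continuous_on UNIV (\<lambda>x. norm (gradient (l i) x - gradient (l' i) x))"
        using R_instance_gradient_continuous[OF inst i] R_instance_gradient_continuous[OF inst' i]
        by (intro continuous_intros)
      fix d assume "d \<in> D"
      then have "(i, d) \<in> range q"
        using q i by simp
      then obtain t where t: "(i, d) = q t"
        by blast
      obtain j x v where Tt: "T t = (j, x, v)"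
        using prod_cases3 .
      then have "T t = (i, d, v)"
        using query[OF Tt] t by (metis prod.inject)
      from reply[OF this] reply'[OF this]
      \<comment> \<open>Both gradients are within \<open>\<epsilon>\<close> of the common reply
        \<open>v\<close>.\<close>
      show "norm (gradient (l i) d - gradient (l' i) d) \<le> 2 * \<epsilon>"
        using norm_triangle_ineq4[of "v - gradient (l' i) d" "v - gradient (l i) d"] by simp
    qed simp_all
    then show ?thesis
      using gap_le_of_gradients_close[OF inst inst' n, of "2 * \<epsilon>"] by simp
  qed
  ultimately show ?thesis
    unfolding guarantees_def by blast
qed

section \<open>Lower bound: two indistinguishable quadratic losses\<close>

lemma ex_run_of_reply_function:
  assumes "\<And>i x. norm (g i x - gradient (l i) x) \<le> \<epsilon> \<and> norm (g i x - gradient (l' i) x) \<le> \<epsilon>"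
  shows "\<exists>T. run \<epsilon> l A T \<and> run \<epsilon> l' A T"
proof -
  define e where "e h = (case next_query A h of (i, x) \<Rightarrow> (i, x, g i x))" for h
  \<comment> \<open>Each exchange depends on all earlier ones, so the history is built by recursion
    and \<open>T\<close> is read off from it. The replies come from \<open>g\<close> alone, so the
    same \<open>T\<close> is a run for both losses.\<close>
  define H where "H = rec_nat [] (\<lambda>_ h. h @ [e h])"
  define T where "T t = e (H t)" for t
  have "H t = map T [0..<t]" for t
    by (induction t) (simp_all add: H_def T_def)
  then have "T t = e (map T [0..<t])" for t
    by (simp add: T_def)
  then have "run \<epsilon> m A T" if "\<And>i x. norm (g i x - gradient (m i) x) \<le> \<epsilon>" for m
    unfolding run_def using that by (auto simp: e_def split: prod.splits)
  then show ?thesis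
    using assms by blast
qed

definition quadratic_loss :: "real \<Rightarrow> 'v::real_inner \<Rightarrow> 'v \<Rightarrow> real" where
  "quadratic_loss a p w = a / 2 * (norm (w - p))\<^sup>2"

lemma GDERIV_quadratic_loss: "GDERIV (quadratic_loss a p) w :> a *\<^sub>R (w - p)"
  unfolding gderiv_def quadratic_loss_def power2_norm_eq_inner
  by (auto intro!: derivative_eq_intros simp: algebra_simps inner_commute)

lemma smooth_with_quadratic_loss:
  assumes "a \<ge> 0"
  shows "smooth_with a (quadratic_loss a p)"
proof -
  have "gradient (quadratic_loss a p) = (\<lambda>w. a *\<^sub>R (w - p))"
    using gradient_eqI[OF GDERIV_quadratic_loss] by blast
  moreover have "a-lipschitz_on UNIV (\<lambda>w. a *\<^sub>R (w - p))"
    using assms by (intro lipschitz_onI) (auto simp: dist_norm simp flip: scaleR_diff_right)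
  moreover have "quadratic_loss a p differentiable (at w)" for w
    using GDERIV_quadratic_loss[of a p w] unfolding gderiv_def differentiable_def by blast
  ultimately show ?thesis
    by (simp add: smooth_with_def)
qed

lemma convex_on_quadratic_loss:
  assumes "a \<ge> 0"
  shows "convex_on UNIV (quadratic_loss a p)"
proof (rule convex_onI)
  fix t :: real and x y
  assume t: "0 < t" "t < 1"
  \<comment> \<open>For a quadratic the convexity defect is known exactly and is visibly
    nonnegative.\<close>
  have "(1 - t) * quadratic_loss a p x + t * quadratic_loss a p y
      - quadratic_loss a p ((1 - t) *\<^sub>R x + t *\<^sub>R y) = a / 2 * (t * (1 - t) * (norm (x - y))\<^sup>2)"
    unfolding quadratic_loss_def power2_norm_eq_inner
    by (simp add: inner_diff inner_add inner_commute) algebra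
  moreover have "a / 2 * (t * (1 - t) * (norm (x - y))\<^sup>2) \<ge> 0"
    using assms t by simp
  ultimately show "quadratic_loss a p ((1 - t) *\<^sub>R x + t *\<^sub>R y)
      \<le> (1 - t) * quadratic_loss a p x + t * quadratic_loss a p y"
    by linarith
qed simp

lemma mean_loss_const:
  assumes "n \<ge> 1"
  shows "mean_loss n (\<lambda>_. f) = f"
  using assms by (auto simp: mean_loss_def)

text \<open>For \<open>a = 0\<close> the loss vanishes identically and its minimizer of smallest
  norm is 0, which forces the last assumption.\<close>

lemma R_instance_quadratic_loss:
  assumes "n \<ge> 1" and "a \<ge> 0" and "norm p \<le> R" and p: "a = 0 \<Longrightarrow> p = 0"
  shows "R_instance R n a (\<lambda>_. quadratic_loss a p) p"
proof -
  have "w = p" if "quadratic_loss a p w \<le> 0" and "a \<noteq> 0" for w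
    using that assms(2) by (auto simp: quadratic_loss_def mult_le_0_iff)
  moreover have "quadratic_loss a p p = 0" "quadratic_loss a p w \<ge> 0" for w
    using assms(2) by (simp_all add: quadratic_loss_def)
  ultimately have "min_norm_minimizer (quadratic_loss a p) p"
    unfolding min_norm_minimizer_def is_arg_min_linorder using p
    by (cases "a = 0") (simp, metis order_refl)
  then show ?thesis
    using assms
    by (simp add: R_instance_def dlagp_instance_def mean_loss_const
        convex_on_quadratic_loss smooth_with_quadratic_loss)
qed

text \<open>The reply \<open>a *\<^sub>R w\<close> misses the gradients for the centres
  \<open>p\<close> and \<open>- p\<close> by exactly \<open>a * norm p\<close>. All clients share
  one loss, so the number of clients does not matter. The case \<open>a = 0\<close> is kept to cover
  degenerate parameters.\<close>

lemma guarantees_imp_ge: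
  fixes A :: "'v::euclidean_space server"
  assumes n: "n \<ge> 1" and a: "a \<ge> 0" and p: "norm p \<le> R" "a = 0 \<Longrightarrow> p = (0::'v)"
    and \<epsilon>: "a * norm p \<le> \<epsilon>" and A: "guarantees n \<epsilon> R a A \<tau>"
  shows "a / 2 * (norm p)\<^sup>2 \<le> \<tau>"
proof -
  let ?l = "\<lambda>p _. quadratic_loss a p"
  have "norm (a *\<^sub>R w - gradient (quadratic_loss a z) w) \<le> \<epsilon>" if "z = p \<or> z = - p" for z w
  proof -
    have "a *\<^sub>R w - gradient (quadratic_loss a z) w = a *\<^sub>R z"
      using gradient_eqI[OF GDERIV_quadratic_loss, of a z w] by (simp add: scaleR_diff_right)
    then show ?thesis
      using that \<epsilon> a by auto
  qed
  then obtain T where "run \<epsilon> (?l p) A T" "run \<epsilon> (?l (- p)) A T"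
    using ex_run_of_reply_function[of "\<lambda>_ w. a *\<^sub>R w" "?l p" \<epsilon> "?l (- p)" A] by blast
  moreover have "R_instance R n a (?l p) p" "R_instance R n a (?l (- p)) (- p)"
    using n a p by (auto intro!: R_instance_quadratic_loss)
  ultimately have "quadratic_loss a p (answer A T) \<le> \<tau>" "quadratic_loss a (- p) (answer A T) \<le> \<tau>"
    using A n unfolding guarantees_def
    by (fastforce simp: mean_loss_const quadratic_loss_def)+
  \<comment> \<open>Parallelogram law: the two gaps at any point sum to at least
    \<open>a * (norm p)\<^sup>2\<close>, so the larger is at least half of that.\<close>
  moreover have "quadratic_loss a p w + quadratic_loss a (- p) w
      = a * (norm w)\<^sup>2 + a * (norm p)\<^sup>2" for w
    unfolding quadratic_loss_def power2_norm_eq_inner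
    by (simp add: inner_diff inner_add inner_commute algebra_simps)
  moreover have "a * (norm (answer A T))\<^sup>2 \<ge> 0"
    using a by simp
  ultimately show ?thesis
    by (smt (verit) field_sum_of_halves times_divide_eq_left)
qed

text \<open>Indexing the servers by \<open>L\<close> expresses that the algorithm may know the
  smoothness constant.\<close>

lemma guarantees_all_smoothness_imp_ge:
  fixes A :: "real \<Rightarrow> 'v::euclidean_space server"
  assumes n: "n \<ge> 1" and "\<epsilon> \<ge> 0" and "R \<ge> 0" and A: "\<And>L. guarantees n \<epsilon> R L (A L) \<tau>"
  shows "\<epsilon> * R / 2 \<le> \<tau>"
proof (cases "\<epsilon> * R = 0")
  case True
  \<comment> \<open>With \<open>a = 0\<close> and \<open>p = 0\<close> the bound reads
    \<open>0 \<le> \<tau>\<close>.\<close>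
  then show ?thesis
    using guarantees_imp_ge[OF n, of 0 0 R \<epsilon> "A 0" \<tau>] assms by auto
next
  case False
  then have pos: "\<epsilon> > 0" "R > 0"
    using assms by auto
  obtain p :: 'v where p: "norm p = R"
    using vector_choose_size[OF \<open>R \<ge> 0\<close>] by blast
  \<comment> \<open>With \<open>norm p = R\<close>, the curvature \<open>\<epsilon> / R\<close> is
    the largest allowed by \<open>a * norm p \<le> \<epsilon>\<close>.\<close>
  have "\<epsilon> / R / 2 * (norm p)\<^sup>2 \<le> \<tau>"
    using pos p A by (intro guarantees_imp_ge[OF n, of "\<epsilon> / R" p R \<epsilon> "A (\<epsilon> / R)"]) auto
  then show ?thesis
    using pos p by (simp add: power2_eq_square)
qed

lemma guarantees_mono:
  assumes "guarantees n \<epsilon> R L A \<sigma>" and "\<sigma> \<le> \<tau>"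
  shows "guarantees n \<epsilon> R L A \<tau>"
  using assms unfolding guarantees_def by (meson order_trans)

theorem mainTheorem1:
  fixes n :: nat and \<epsilon> R :: real
  assumes "n \<ge> 1" and "\<epsilon> \<ge> 0" and "R \<ge> 0"
  shows "tau_min TYPE('d::finite) n \<epsilon> R \<in> {\<epsilon> * R / 2 .. 5 * \<epsilon> * R}
    \<and> (\<forall>\<tau> < \<epsilon> * R / 2.
         \<not> (\<exists>A :: real \<Rightarrow> (real ^ 'd) server. \<forall>L. guarantees n \<epsilon> R L (A L) \<tau>))
    \<and> (\<forall>\<tau> \<ge> 5 * \<epsilon> * R.
         \<exists>A :: (real ^ 'd) server. \<forall>L. guarantees n \<epsilon> R L A \<tau>)"
proof -
  have lower: "\<epsilon> * R / 2 \<le> \<tau>"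
    if "\<And>L. guarantees n \<epsilon> R L (A L) \<tau>" for \<tau> and A :: "real \<Rightarrow> (real ^ 'd) server"
    using guarantees_all_smoothness_imp_ge[OF assms that] .
  obtain B :: "(real ^ 'd) server" where B: "\<And>L. guarantees n \<epsilon> R L B (4 * \<epsilon> * R)"
    using ex_server_guarantees[OF assms(1)] by blast
  have "4 * \<epsilon> * R \<le> 5 * \<epsilon> * R"
    using assms by (simp add: mult_right_mono)
  then have upper: "\<exists>A :: (real ^ 'd) server. \<forall>L. guarantees n \<epsilon> R L A \<tau>" if "\<tau> \<ge> 5 * \<epsilon> * R" for \<tau>
    using guarantees_mono[OF B] that by (meson order_trans)
  let ?S = "{\<tau>. \<exists>A :: (real ^ 'd) server. \<forall>L. guarantees n \<epsilon> R L A \<tau>}"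
  have mem: "5 * \<epsilon> * R \<in> ?S"
    using upper by blast
  \<comment> \<open>A server ignorant of \<open>L\<close> is a constant family of servers.\<close>
  have bound: "\<epsilon> * R / 2 \<le> \<tau>" if "\<tau> \<in> ?S" for \<tau>
    using that lower[of "\<lambda>_. A" \<tau> for A] by blast
  have "\<epsilon> * R / 2 \<le> Inf ?S"
    using mem bound by (intro cInf_greatest) blast
  \<comment> \<open>A real infimum lies below the members only of a set bounded below, which
    \<open>bound\<close> ensures.\<close>
  moreover have "Inf ?S \<le> 5 * \<epsilon> * R"
    using mem bound by (intro cInf_lower bdd_belowI)
  ultimately have "tau_min TYPE('d) n \<epsilon> R \<in> {\<epsilon> * R / 2 .. 5 * \<epsilon> * R}"
    by (simp add: tau_min_def)
  moreover have "\<not> (\<exists>A :: real \<Rightarrow> (real ^ 'd) server. \<forall>L. guarantees n \<epsilon> R L (A L) \<tau>)"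
    if "\<tau> < \<epsilon> * R / 2" for \<tau>
    using that lower[of _ \<tau>] by (metis not_le)
  ultimately show ?thesis
    using upper by blast
qed

end
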